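(* Every $2$-degenerate graph $G$ is equitable list point $k$-arborable for every integer $k\geq \lceil (\Delta(G)+1)/2\rceil$, where $\Delta(G)$ is the maximum degree of $G$.
   Context: All graphs are finite, simple and undirected. A graph is $d$-degenerate if every subgraph of it has a vertex of degree at most $d$. A $k$-list assignment of a graph $G$ assigns to each vertex $v$ a set (list) $L(v)$ of $k$ colors. A graph $G$ is equitable list point $k$-arborable if for every $k$-list assignment $L$ one can choose $c(v)\in L(v)$ for each vertex $v$ such that each color class induces an acyclic subgraph (a forest) of $G$ and each color appears on at most $\lceil |V(G)|/k\rceil$ vertices of $G$. *)

theory Defs
  imports Complex_Main "Graph_Theory.Graph_Theory"
begin

text \<open>
  A finite simple undirected graph is a loop-free symmetric digraph without multiple arcs
  (locale \<^locale>\<open>graph\<close>): every edge is represented by its two opposite arcs. Hence the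
  degree of a vertex is its out-degree, and the undirected subgraphs of \<open>G\<close> are those
  \<open>H\<close> with \<^term>\<open>subgraph H G\<close> that are themselves symmetric.
\<close>

abbreviation degree :: "('a, 'b) pre_digraph \<Rightarrow> 'a \<Rightarrow> nat" where
  "degree G v \<equiv> out_degree G v"

(* The inserted 0 gives the null graph maximum degree 0 and is harmless otherwise. *)
definition max_degree :: "('a, 'b) pre_digraph \<Rightarrow> nat" where
  "max_degree G = Max (insert 0 (degree G ` verts G))"

definition degenerate :: "nat \<Rightarrow> ('a, 'b) pre_digraph \<Rightarrow> bool" where
  "degenerate d G \<longleftrightarrow>
    (\<forall>H. subgraph H G \<and> graph H \<and> verts H \<noteq> {} \<longrightarrow> (\<exists>v \<in> verts H. degree H v \<le> d))"

(* In a symmetric digraph the back-and-forth walk u, v, u along an edge satisfies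
   pre_digraph.cycle, so the library's forest predicate only holds for edgeless graphs.
   The undirected cycles of a simple graph are the directed ones of length at least 3. *)
definition acyclic_graph :: "('a, 'b) pre_digraph \<Rightarrow> bool" where
  "acyclic_graph G \<longleftrightarrow> \<not> (\<exists>p. pre_digraph.cycle G p \<and> 3 \<le> length p)"

definition list_assignment :: "('a, 'b) pre_digraph \<Rightarrow> nat \<Rightarrow> ('a \<Rightarrow> 'c set) \<Rightarrow> bool" where
  "list_assignment G k L \<longleftrightarrow> (\<forall>v \<in> verts G. finite (L v) \<and> card (L v) = k)"

definition color_class :: "('a, 'b) pre_digraph \<Rightarrow> ('a \<Rightarrow> 'c) \<Rightarrow> 'c \<Rightarrow> 'a set" where
  "color_class G c x = {v \<in> verts G. c v = x}"

(* The first argument only fixes the type the colors are drawn from. *)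
definition equitable_list_point_arborable ::
    "'c itself \<Rightarrow> nat \<Rightarrow> ('a, 'b) pre_digraph \<Rightarrow> bool" where
  "equitable_list_point_arborable (_ :: 'c itself) k G \<longleftrightarrow>
    (\<forall>L :: 'a \<Rightarrow> 'c set. list_assignment G k L \<longrightarrow>
      (\<exists>c :: 'a \<Rightarrow> 'c.
        (\<forall>v \<in> verts G. c v \<in> L v) \<and>
        (\<forall>x. acyclic_graph (G \<restriction> color_class G c x)) \<and>
        (\<forall>x. int (card (color_class G c x)) \<le> \<lceil>real (card (verts G)) / real k\<rceil>)))"

end

theory Submission
  imports Defs
begin

text \<open>
  Induct on the number of vertices, removing a block of \<open>k \<ge> 2\<close> vertices at a time. The block consists
  of a vertex \<open>x\<close> of degree at most 2, a neighbor \<open>y\<close> of \<open>x\<close> (any other vertex if \<open>x\<close> is isolated),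
  and \<open>k - 2\<close> further vertices obtained by repeatedly taking a vertex of degree at most 2 from what
  is left. Given a coloring of the rest, color \<open>y\<close> first, then the \<open>k - 2\<close> vertices, then \<open>x\<close>, with
  pairwise distinct colors, each vertex avoiding every color that occurs twice among its neighbors
  outside the block. There are at most \<open>k - 1\<close>, 1 and 0 such repeated colors, respectively, so a
  color always remains. Every new vertex then has at most one neighbor of its own color, which
  creates no monochromatic cycle, and every color class grows by at most one.
\<close>

definition neighbors :: "('a, 'b) pre_digraph \<Rightarrow> 'a \<Rightarrow> 'a set" where
  "neighbors G v = {u. v \<rightarrow>\<^bsub>G\<^esub> u}"

lemma (in wf_digraph) neighbors_subset_verts: "neighbors G v \<subseteq> verts G"
  by (auto simp: neighbors_def)

lemma (in fin_digraph) finite_neighbors: "finite (neighbors G v)"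
  using neighbors_subset_verts finite_verts by (rule finite_subset)

lemma (in loopfree_digraph) not_in_neighbors_self: "v \<notin> neighbors G v"
  by (auto simp: neighbors_def dest: adj_not_same)

lemma neighbors_induce_subgraph:
  assumes "v \<in> W"
  shows "neighbors (G \<restriction> W) v = neighbors G v \<inter> W"
  using assms by (auto simp: neighbors_def arcs_ends_conv)

lemma (in nomulti_digraph) degree_eq_card_neighbors: "degree G v = card (neighbors G v)"
proof -
  have "neighbors G v = head G ` out_arcs G v"
    by (auto simp: neighbors_def arcs_ends_conv)
  moreover have "inj_on (head G) (out_arcs G v)"
    by (rule inj_onI) (auto intro: no_multi_arcs simp: arc_to_ends_def)
  ultimately show ?thesis
    by (simp add: out_degree_def card_image)
qed

lemma (in digraph) card_neighbors_Diff_le_degree: "card (neighbors G v - S) \<le> degree G v"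
  unfolding degree_eq_card_neighbors by (simp add: card_mono finite_neighbors)

lemma induce_subgraph_induce_subgraph:
  assumes "X \<subseteq> W"
  shows "(G \<restriction> W) \<restriction> X = G \<restriction> X"
  using assms by (auto simp: induce_subgraph_def)

lemma (in graph) graph_induce_subgraph:
  assumes "W \<subseteq> verts G"
  shows "graph (G \<restriction> W)"
  using induced_induce[OF assms]
  by (intro digraph.graphI digraphI_induced induced_graph_imp_symmetric[OF sym_arcs])

lemma (in graph) degree_induce_subgraph:
  assumes "W \<subseteq> verts G" "v \<in> W"
  shows "degree (G \<restriction> W) v = card (neighbors G v \<inter> W)"
proof -
  interpret induced: graph "G \<restriction> W"
    using assms(1) by (rule graph_induce_subgraph)
  show ?thesis
    using assms(2) by (simp add: induced.degree_eq_card_neighbors neighbors_induce_subgraph)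
qed

lemma (in graph) degree_induce_subgraph_le:
  assumes "W \<subseteq> verts G" "v \<in> W"
  shows "degree (G \<restriction> W) v \<le> degree G v"
  by (simp add: degree_induce_subgraph[OF assms] degree_eq_card_neighbors card_mono finite_neighbors)

lemma degenerate_subgraph:
  assumes "degenerate d G" "subgraph H G"
  shows "degenerate d H"
  using assms subgraph_trans unfolding degenerate_def by blast

lemma (in graph) degenerate_obtains_small_degree:
  assumes "degenerate d G" "W \<subseteq> verts G" "W \<noteq> {}"
  obtains v where "v \<in> W" "card (neighbors G v \<inter> W) \<le> d"
proof -
  have "subgraph (G \<restriction> W) G" "graph (G \<restriction> W)"
    using assms(2) by (rule subgraph_induce_subgraphI graph_induce_subgraph)+
  then obtain v where "v \<in> W" "degree (G \<restriction> W) v \<le> d"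
    using assms(1,3) unfolding degenerate_def by force
  then show ?thesis
    using assms(2) that by (simp add: degree_induce_subgraph)
qed

lemma (in graph) degenerate_Suc_obtains_small_degree_Diff:
  assumes "degenerate (Suc d) G" "2 \<le> card (verts G)"
  obtains x y where "x \<in> verts G" "y \<in> verts G" "x \<noteq> y" "card (neighbors G x - {y}) \<le> d"
proof -
  have "verts G \<noteq> {}"
    using assms(2) by auto
  then obtain x where x: "x \<in> verts G" "card (neighbors G x) \<le> Suc d"
    using degenerate_obtains_small_degree[OF assms(1) order_refl]
    by (metis inf_absorb1 neighbors_subset_verts)
  show ?thesis
  proof (cases "neighbors G x = {}")
    case True
    have "\<not> verts G \<subseteq> {x}"
      using assms(2) card_mono[of "{x}" "verts G"] by auto
    then obtain y where "y \<in> verts G" "x \<noteq> y"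
      by blast
    with True x(1) show ?thesis
      by (intro that[of x y]) auto
  next
    case False
    then obtain y where y: "y \<in> neighbors G x"
      by blast
    then have "y \<in> verts G" "x \<noteq> y"
      using neighbors_subset_verts not_in_neighbors_self by blast+
    with x y show ?thesis
      by (intro that[of x y]) (auto simp: card_Diff_singleton)
  qed
qed

lemma (in graph) degenerate_obtains_peeled_set:
  assumes "degenerate d G" "W \<subseteq> verts G" "m \<le> card W"
  obtains M where "M \<subseteq> W" "card M = m" "\<And>v. v \<in> M \<Longrightarrow> card (neighbors G v \<inter> (W - M)) \<le> d"
  using assms(3)
proof (induction m arbitrary: thesis)
  case 0
  show ?case
    by (rule "0.prems"(1)[of "{}"]) auto
next
  case (Suc m)
  then obtain M where M: "M \<subseteq> W" "card M = m"
    and small: "\<And>v. v \<in> M \<Longrightarrow> card (neighbors G v \<inter> (W - M)) \<le> d"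
    by (metis Suc_leD)
  have "finite M"
    using M(1) assms(2) finite_verts by (meson finite_subset)
  have "W - M \<noteq> {}" "W - M \<subseteq> verts G"
    using M Suc.prems(2) assms(2) by auto
  then obtain v where v: "v \<in> W - M" "card (neighbors G v \<inter> (W - M)) \<le> d"
    using degenerate_obtains_small_degree[OF assms(1)] by metis
  have "card (neighbors G w \<inter> (W - insert v M)) \<le> d" if "w \<in> insert v M" for w
  proof -
    have "card (neighbors G w \<inter> (W - insert v M)) \<le> card (neighbors G w \<inter> (W - M))"
      by (rule card_mono) (auto simp: finite_neighbors)
    also have "\<dots> \<le> d"
      using that v(2) small by auto
    finally show ?thesis .
  qed
  then show ?case
    using v(1) M \<open>finite M\<close> by (intro Suc.prems(1)[of "insert v M"]) auto
qed

lemma (in wf_digraph) set_awalk_verts_closed: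
  assumes "awalk u p u" "p \<noteq> []"
  shows "set (awalk_verts u p) = head G ` set p"
proof -
  have "cas u p u"
    using assms(1) by blast
  then have "awalk_verts u p = u # map (head G) p"
    using assms(2) cas_simp awalk_verts_conv' by metis
  moreover have "u = head G (last p)"
    using assms by (auto simp: awalk_verts_conv)
  then have "u \<in> head G ` set p"
    using assms(2) by simp
  ultimately show ?thesis
    by (simp add: insert_absorb)
qed

lemma (in pseudo_graph) degree_ge_2_if_in_cycle:
  assumes "cycle p" "3 \<le> length p" "v \<in> head G ` set p"
  shows "2 \<le> degree G v"
proof -
  obtain u where walk: "awalk u p u" and "distinct (tl (awalk_verts u p))" "p \<noteq> []"
    using assms(1) unfolding cycle_def by blast
  then have distinct_heads: "distinct (map (head G) p)" and "v \<in> set (awalk_verts u p)"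
    using assms(3) by (auto simp: awalk_verts_conv' set_awalk_verts_closed)
  then obtain q r where p: "p = q @ r" and rotated: "awalk v (r @ q) v"
    using rotate_awalkE[OF walk] by metis
  have "3 \<le> length (r @ q)"
    using assms(2) p by simp
  then obtain leaving t where "r @ q = leaving # t" "2 \<le> length (rev t)"
    by (cases "r @ q") auto
  then obtain s previous entering where decomp: "r @ q = leaving # rev s @ [previous, entering]"
    by (auto simp: numeral_2_eq_2 Suc_le_length_iff rev_eq_Cons_iff simp del: length_rev)
  then have leaving: "leaving \<in> arcs G" "tail G leaving = v"
    and entering: "entering \<in> arcs G" "head G entering = v" "tail G entering = head G previous"
    using rotated by (auto simp: awalk_simps)
  obtain opposite where opposite: "opposite \<in> arcs G" "tail G opposite = v"
    "head G opposite = head G previous"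
    using sym_arcs entering unfolding symmetric_conv by metis
  have "distinct (map (head G) (r @ q))"
    using distinct_heads p by auto
  then have "leaving \<noteq> opposite"
    using decomp opposite(3) by auto
  moreover have "card {leaving, opposite} \<le> degree G v"
    unfolding out_degree_def using leaving opposite by (intro card_mono) auto
  ultimately show ?thesis
    by simp
qed

lemma (in graph) acyclic_graph_if_delete_leaf:
  assumes "degree G v \<le> 1" "acyclic_graph (G \<restriction> (verts G - {v}))"
  shows "acyclic_graph G"
  unfolding acyclic_graph_def
proof safe
  fix p
  assume "cycle p" and "3 \<le> length p"
  then obtain u where walk: "awalk u p u" "distinct (tl (awalk_verts u p))" "p \<noteq> []"
    unfolding cycle_def by blast
  have "v \<notin> head G ` set p"
    using degree_ge_2_if_in_cycle[OF \<open>cycle p\<close> \<open>3 \<le> length p\<close>, of v] assms(1) by auto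
  then have "v \<notin> set (awalk_verts u p)"
    by (simp add: set_awalk_verts_closed[OF walk(1,3)])
  moreover have "set (awalk_verts u p) \<subseteq> verts G"
    using walk(1) by blast
  ultimately have "set (awalk_verts u p) \<subseteq> verts G - {v}"
    by blast
  then have "pre_digraph.cycle (G \<restriction> (verts G - {v})) p"
    using walk awalk_induce unfolding pre_digraph.cycle_def awalk_verts_induce by blast
  with assms(2) \<open>3 \<le> length p\<close> show False
    unfolding acyclic_graph_def by blast
qed

lemma (in graph) acyclic_graph_induce_insert:
  assumes "insert v X \<subseteq> verts G" "card (neighbors G v \<inter> X) \<le> 1" "acyclic_graph (G \<restriction> X)"
  shows "acyclic_graph (G \<restriction> insert v X)"
proof (cases "v \<in> X")
  case True
  with assms(3) show ?thesis
    by (simp add: insert_absorb)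
next
  case False
  interpret induced: graph "G \<restriction> insert v X"
    using assms(1) by (rule graph_induce_subgraph)
  show ?thesis
  proof (rule induced.acyclic_graph_if_delete_leaf)
    have "neighbors G v \<inter> insert v X = neighbors G v \<inter> X"
      using not_in_neighbors_self by auto
    then show "degree (G \<restriction> insert v X) v \<le> 1"
      using assms(1,2) by (simp add: degree_induce_subgraph)
    have "(G \<restriction> insert v X) \<restriction> (verts (G \<restriction> insert v X) - {v}) = G \<restriction> X"
      using False by (simp add: induce_subgraph_induce_subgraph subset_insertI)
    with assms(3) show "acyclic_graph ((G \<restriction> insert v X) \<restriction> (verts (G \<restriction> insert v X) - {v}))"
      by simp
  qed
qed

lemma inj_on_choice_if_index_less_card:
  assumes "distinct vs" "\<And>j. j < length vs \<Longrightarrow> j < card (A (vs ! j))"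
  obtains f where "inj_on f (set vs)" "\<And>v. v \<in> set vs \<Longrightarrow> f v \<in> A v"
  using assms
proof (induction vs arbitrary: thesis rule: rev_induct)
  case Nil
  then show ?case
    by simp
next
  case (snoc v vs)
  have "j < card (A (vs ! j))" if "j < length vs" for j
    using snoc.prems(3)[of j] that by (simp add: nth_append)
  then obtain f where f: "inj_on f (set vs)" "\<And>w. w \<in> set vs \<Longrightarrow> f w \<in> A w"
    using snoc.IH snoc.prems(2) by auto
  have "card (f ` set vs) \<le> length vs"
    using card_image_le[of "set vs" f] card_length[of vs] by simp
  also have "\<dots> < card (A v)"
    using snoc.prems(3)[of "length vs"] by simp
  finally have "\<not> A v \<subseteq> f ` set vs"
    using card_mono[of "f ` set vs" "A v"] by auto
  then obtain a where "a \<in> A v" "a \<notin> f ` set vs"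
    by blast
  with f snoc.prems(2) show ?case
    by (intro snoc.prems(1)[of "f(v := a)"]) (auto simp: inj_on_def)
qed

definition repeated_values :: "('a \<Rightarrow> 'b) \<Rightarrow> 'a set \<Rightarrow> 'b set" where
  "repeated_values f A = {x. 2 \<le> card {a \<in> A. f a = x}}"

lemma finite_repeated_values:
  assumes "finite A"
  shows "finite (repeated_values f A)"
proof (rule finite_subset)
  show "repeated_values f A \<subseteq> f ` A"
  proof
    fix x
    assume "x \<in> repeated_values f A"
    then have "{a \<in> A. f a = x} \<noteq> {}"
      by (auto simp: repeated_values_def simp del: Collect_empty_eq)
    then show "x \<in> f ` A"
      by blast
  qed
qed (use assms in simp)

lemma card_repeated_values_le:
  assumes "finite A"
  shows "card (repeated_values f A) \<le> card A div 2"
proof -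
  have "card (repeated_values f A) * 2 \<le> (\<Sum>x\<in>repeated_values f A. card {a \<in> A. f a = x})"
    using sum_mono[of "repeated_values f A" "\<lambda>_. 2" "\<lambda>x. card {a \<in> A. f a = x}"]
    by (simp add: repeated_values_def)
  also have "\<dots> = card (\<Union>x\<in>repeated_values f A. {a \<in> A. f a = x})"
    using assms by (subst card_UN_disjoint) (auto simp: finite_repeated_values)
  also have "\<dots> \<le> card A"
    using assms by (intro card_mono) auto
  finally show ?thesis
    by linarith
qed

lemma color_class_override_on_cases:
  assumes "S \<subseteq> verts G" "inj_on e S"
  obtains (same) "color_class G (override_on c e S) x = color_class (G \<restriction> (verts G - S)) c x"
  | (insert) v where "v \<in> S" "e v = x"
      "color_class G (override_on c e S) x = insert v (color_class (G \<restriction> (verts G - S)) c x)"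
proof (cases "x \<in> e ` S")
  case True
  then obtain v where "v \<in> S" "e v = x"
    by blast
  with assms show ?thesis
    by (intro insert) (auto simp: color_class_def override_on_def inj_on_def)
next
  case False
  with assms(1) show ?thesis
    by (intro same) (auto simp: color_class_def override_on_def)
qed

lemma (in fin_digraph) card_color_class_override_on_le:
  assumes "S \<subseteq> verts G" "inj_on e S"
  shows "card (color_class G (override_on c e S) x) \<le>
    Suc (card (color_class (G \<restriction> (verts G - S)) c x))"
proof -
  have "finite (color_class (G \<restriction> (verts G - S)) c x)"
    by (simp add: color_class_def)
  then show ?thesis
    by (cases rule: color_class_override_on_cases[OF assms, of c x]) (simp_all add: card_insert_if)
qed

lemma (in graph) acyclic_color_class_override_on:
  assumes "S \<subseteq> verts G" "inj_on e S"
    and not_repeated: "\<And>v. v \<in> S \<Longrightarrow> e v \<notin> repeated_values c (neighbors G v - S)"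
    and acyclic: "acyclic_graph ((G \<restriction> (verts G - S)) \<restriction> color_class (G \<restriction> (verts G - S)) c x)"
  shows "acyclic_graph (G \<restriction> color_class G (override_on c e S) x)"
proof -
  define C where "C = color_class (G \<restriction> (verts G - S)) c x"
  have C_subset: "C \<subseteq> verts G - S"
    by (auto simp: C_def color_class_def)
  then have acyclic_C: "acyclic_graph (G \<restriction> C)"
    using acyclic by (simp add: C_def induce_subgraph_induce_subgraph)
  from assms(1,2) show ?thesis
  proof (cases rule: color_class_override_on_cases[where c = c and x = x])
    case same
    with acyclic_C show ?thesis
      by (simp add: C_def)
  next
    case (insert v)
    have "neighbors G v \<inter> C = {u \<in> neighbors G v - S. c u = e v}"
      using insert(2) neighbors_subset_verts by (auto simp: C_def color_class_def)
    then have "card (neighbors G v \<inter> C) \<le> 1"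
      using not_repeated[OF insert(1)] by (simp add: repeated_values_def)
    moreover have "insert v C \<subseteq> verts G"
      using insert(1) assms(1) C_subset by blast
    ultimately show ?thesis
      using acyclic_C insert(3) acyclic_graph_induce_insert by (simp add: C_def)
  qed
qed

text \<open>
  When a block is colored from left to right, \<open>vs ! j\<close> must avoid \<open>j\<close> colors used in the block and
  the colors repeated on its outer neighbors, of which there are at most half as many as neighbors.
\<close>

definition removable_block :: "nat \<Rightarrow> ('a, 'b) pre_digraph \<Rightarrow> 'a list \<Rightarrow> bool" where
  "removable_block k G vs \<longleftrightarrow> distinct vs \<and> set vs \<subseteq> verts G \<and>
    (\<forall>j < length vs. j + card (neighbors G (vs ! j) - set vs) div 2 < k)"

lemma (in fin_digraph) removable_block_obtains_coloring:
  assumes "removable_block k G vs" "list_assignment G k L"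
  obtains e where "inj_on e (set vs)"
    "\<And>v. v \<in> set vs \<Longrightarrow> e v \<in> L v \<and> e v \<notin> repeated_values c (neighbors G v - set vs)"
proof -
  define A where "A v = L v - repeated_values c (neighbors G v - set vs)" for v
  have "j < card (A (vs ! j))" if "j < length vs" for j
  proof -
    let ?N = "neighbors G (vs ! j) - set vs"
    have "vs ! j \<in> verts G" and slot: "j + card ?N div 2 < k"
      using assms(1) that nth_mem unfolding removable_block_def by blast+
    then have "card (L (vs ! j)) = k"
      using assms(2) by (simp add: list_assignment_def)
    moreover have "finite ?N"
      by (simp add: finite_neighbors)
    then have "card (L (vs ! j)) - card ?N div 2 \<le> card (A (vs ! j))"
      unfolding A_def
      by (meson card_repeated_values_le diff_card_le_card_Diff diff_le_mono2 finite_repeated_values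
          order_trans)
    ultimately show ?thesis
      using slot by linarith
  qed
  moreover have "distinct vs"
    using assms(1) by (simp add: removable_block_def)
  ultimately obtain e where "inj_on e (set vs)" "\<And>v. v \<in> set vs \<Longrightarrow> e v \<in> A v"
    using inj_on_choice_if_index_less_card by blast
  then show ?thesis
    by (intro that[of e]) (auto simp: A_def)
qed

lemma ceiling_divide_eq_Suc_diff:
  fixes n k :: nat
  assumes "0 < n" "0 < k"
  shows "\<lceil>real n / real k\<rceil> = \<lceil>real (n - k) / real k\<rceil> + 1"
proof (cases "n \<le> k")
  case True
  with assms show ?thesis
    by (simp add: ceiling_eq_iff)
next
  case False
  then have "real n / real k = real (n - k) / real k + 1"
    using assms(2) by (simp add: of_nat_diff field_simps)
  then show ?thesis
    by simp
qed

lemma (in fin_digraph) equitable_color_class_override_on: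
  fixes k :: nat
  assumes S: "S \<subseteq> verts G" "inj_on e S" "S \<noteq> {}" "card S = min k (card (verts G))"
    and rest: "int (card (color_class (G \<restriction> (verts G - S)) c x)) \<le>
      \<lceil>real (card (verts (G \<restriction> (verts G - S)))) / real k\<rceil>"
  shows "int (card (color_class G (override_on c e S) x)) \<le> \<lceil>real (card (verts G)) / real k\<rceil>"
proof -
  have "finite S"
    using S(1) finite_verts by (rule finite_subset)
  then have "0 < min k (card (verts G))"
    using S(3,4) by (metis card_gt_0_iff)
  then have positive: "0 < card (verts G)" "0 < k"
    unfolding min_less_iff_conj by blast+
  have "card (verts (G \<restriction> (verts G - S))) = card (verts G) - k"
    using S(1,4) \<open>finite S\<close> by (simp add: card_Diff_subset)
  then have "\<lceil>real (card (verts G)) / real k\<rceil> =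
      \<lceil>real (card (verts (G \<restriction> (verts G - S)))) / real k\<rceil> + 1"
    using positive by (simp only: ceiling_divide_eq_Suc_diff)
  with card_color_class_override_on_le[OF S(1,2), of c x] rest show ?thesis
    by linarith
qed

lemma (in graph) equitable_list_point_arborable_if_removable_block:
  assumes block: "removable_block k G vs" "vs \<noteq> []" "length vs = min k (card (verts G))"
    and rest: "equitable_list_point_arborable TYPE('c) k (G \<restriction> (verts G - set vs))"
  shows "equitable_list_point_arborable TYPE('c) k G"
  unfolding equitable_list_point_arborable_def
proof (intro allI impI)
  fix L :: "'a \<Rightarrow> 'c set"
  assume L: "list_assignment G k L"
  have S: "distinct vs" "set vs \<subseteq> verts G"
    using block(1) by (auto simp: removable_block_def)
  let ?R = "G \<restriction> (verts G - set vs)"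
  have "list_assignment ?R k L"
    using L by (simp add: list_assignment_def)
  then obtain c where c_in_list: "\<forall>v \<in> verts ?R. c v \<in> L v"
    and c_acyclic: "\<forall>x. acyclic_graph (?R \<restriction> color_class ?R c x)"
    and c_equitable: "\<forall>x. int (card (color_class ?R c x)) \<le> \<lceil>real (card (verts ?R)) / real k\<rceil>"
    using rest unfolding equitable_list_point_arborable_def by blast
  obtain e where e: "inj_on e (set vs)"
    "\<And>v. v \<in> set vs \<Longrightarrow> e v \<in> L v \<and> e v \<notin> repeated_values c (neighbors G v - set vs)"
    using removable_block_obtains_coloring[OF block(1) L] by blast
  define c' where "c' = override_on c e (set vs)"
  have "\<forall>v \<in> verts G. c' v \<in> L v"
    using c_in_list e(2) by (simp add: c'_def override_on_def)
  moreover have "acyclic_graph (G \<restriction> color_class G c' x)" for x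
    unfolding c'_def using S(2) e c_acyclic by (intro acyclic_color_class_override_on) simp_all
  moreover have "int (card (color_class G c' x)) \<le> \<lceil>real (card (verts G)) / real k\<rceil>" for x
    unfolding c'_def using S(2) e(1)
  proof (rule equitable_color_class_override_on)
    show "set vs \<noteq> {}" "card (set vs) = min k (card (verts G))"
      using block(2,3) distinct_card[OF S(1)] by simp_all
  qed (use c_equitable in blast)
  ultimately show "\<exists>c. (\<forall>v \<in> verts G. c v \<in> L v) \<and>
      (\<forall>x. acyclic_graph (G \<restriction> color_class G c x)) \<and>
      (\<forall>x. int (card (color_class G c x)) \<le> \<lceil>real (card (verts G)) / real k\<rceil>)"
    by blast
qed

lemma removable_block_Cons_snocI:
  assumes vs: "vs = y # ms @ [x]" "distinct vs" "set vs \<subseteq> verts G" "length vs \<le> k"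
    and first_slot: "card (neighbors G y - set vs) < 2 * k"
    and middle_slot: "\<And>v. v \<in> set ms \<Longrightarrow> card (neighbors G v - set vs) \<le> 2"
    and last_slot: "card (neighbors G x - set vs) \<le> 1"
  shows "removable_block k G vs"
proof -
  have "j + card (neighbors G (vs ! j) - set vs) div 2 < k" if j_less: "j < length vs" for j
  proof -
    consider (first) "j = 0" | (middle) i where "j = Suc i" "i < length ms"
      | (last) "j = Suc (length ms)"
      using j_less by (cases j) (auto simp: vs(1) less_Suc_eq)
    then show ?thesis
    proof cases
      case first
      with first_slot show ?thesis
        by (simp add: vs(1))
    next
      case middle
      then have "vs ! j \<in> set ms"
        by (simp add: vs(1) nth_append)
      then have "card (neighbors G (vs ! j) - set vs) div 2 \<le> 1"
        using middle_slot by fastforce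
      with middle vs(1,4) show ?thesis
        by simp
    next
      case last
      with last_slot vs(1,4) show ?thesis
        by (simp add: nth_append)
    qed
  qed
  with vs(2,3) show ?thesis
    by (simp add: removable_block_def)
qed

lemma (in graph) degenerate_2_obtains_removable_block:
  assumes "degenerate 2 G" "2 \<le> k" "k \<le> card (verts G)"
    and degree_less: "\<And>v. v \<in> verts G \<Longrightarrow> degree G v < 2 * k"
  obtains vs where "removable_block k G vs" "length vs = k"
proof -
  have "degenerate (Suc 1) G" "2 \<le> card (verts G)"
    using assms(1-3) by (simp_all add: numeral_2_eq_2)
  then obtain x y where xy: "x \<in> verts G" "y \<in> verts G" "x \<noteq> y"
    and small_x: "card (neighbors G x - {y}) \<le> 1"
    by (rule degenerate_Suc_obtains_small_degree_Diff)
  define W where "W = verts G - {x, y}"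
  have "W \<subseteq> verts G" "k - 2 \<le> card W"
    using xy assms(3) by (auto simp: W_def card_Diff_subset)
  then obtain M where M: "M \<subseteq> W" "card M = k - 2"
    and small_M: "\<And>v. v \<in> M \<Longrightarrow> card (neighbors G v \<inter> (W - M)) \<le> 2"
    using degenerate_obtains_peeled_set[OF assms(1)] by metis
  have "finite M"
    using M(1) \<open>W \<subseteq> verts G\<close> finite_verts by (meson finite_subset)
  then obtain ms where ms: "set ms = M" "distinct ms" "length ms = k - 2"
    using finite_distinct_list distinct_card M(2) by metis
  define vs where "vs = y # ms @ [x]"
  have length: "length vs = k"
    using ms(3) assms(2) by (simp add: vs_def)
  have "removable_block k G vs"
  proof (rule removable_block_Cons_snocI[OF vs_def _ _ eq_refl[OF length]])
    show "distinct vs" "set vs \<subseteq> verts G"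
      using M(1) ms xy by (auto simp: vs_def W_def)
    show "card (neighbors G y - set vs) < 2 * k"
      using card_neighbors_Diff_le_degree degree_less[OF xy(2)] by (rule le_less_trans)
    have "neighbors G v - set vs = neighbors G v \<inter> (W - M)" for v
      using neighbors_subset_verts ms(1) by (auto simp: vs_def W_def)
    then show "card (neighbors G v - set vs) \<le> 2" if "v \<in> set ms" for v
      using small_M that ms(1) by simp
    have "card (neighbors G x - set vs) \<le> card (neighbors G x - {y})"
      by (rule card_mono) (auto simp: finite_neighbors vs_def)
    with small_x show "card (neighbors G x - set vs) \<le> 1"
      by linarith
  qed
  with length show ?thesis
    using that by blast
qed

lemma (in graph) degenerate_2_obtains_removable_block_min:
  assumes "degenerate 2 G" "verts G \<noteq> {}"
    and degree_less: "\<And>v. v \<in> verts G \<Longrightarrow> degree G v < 2 * k"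
  obtains vs where "removable_block k G vs" "length vs = min k (card (verts G))" "vs \<noteq> []"
proof -
  obtain x where x: "x \<in> verts G"
    using assms(2) by blast
  consider (few_vertices) "card (verts G) \<le> k" | (singleton) "k = 1" "1 < card (verts G)"
    | (general) "2 \<le> k" "k \<le> card (verts G)"
    using degree_less[OF x] by linarith
  then show ?thesis
  proof cases
    case few_vertices
    obtain vs where vs: "set vs = verts G" "distinct vs"
      using finite_distinct_list finite_verts by blast
    then have length: "length vs = card (verts G)"
      using distinct_card by metis
    have no_outside_neighbors: "neighbors G v - verts G = {}" for v
      using neighbors_subset_verts by blast
    have "removable_block k G vs"
      using few_vertices vs length by (simp add: removable_block_def no_outside_neighbors)
    with few_vertices vs(1) length assms(2) show ?thesis
      by (intro that[of vs]) auto
  next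
    case singleton
    with card_neighbors_Diff_le_degree[of x "{x}"] x degree_less[OF x] show ?thesis
      by (intro that[of "[x]"]) (auto simp: removable_block_def)
  next
    case general
    then obtain vs where "removable_block k G vs" "length vs = k"
      using degenerate_2_obtains_removable_block[OF assms(1) _ _ degree_less] by blast
    with general show ?thesis
      by (intro that[of vs]) auto
  qed
qed

lemma equitable_list_point_arborable_if_verts_empty:
  assumes "verts G = {}"
  shows "equitable_list_point_arborable TYPE('c) k G"
proof -
  have "acyclic_graph (G \<restriction> {})"
    by (simp add: acyclic_graph_def pre_digraph.cycle_def pre_digraph.awalk_def)
  with assms show ?thesis
    by (simp add: equitable_list_point_arborable_def color_class_def)
qed

lemma degenerate_2_imp_equitable_list_point_arborable:
  assumes "graph G" "degenerate 2 G" "\<And>v. v \<in> verts G \<Longrightarrow> degree G v < 2 * k"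
  shows "equitable_list_point_arborable TYPE('c) k G"
  using assms
proof (induction "card (verts G)" arbitrary: G rule: less_induct)
  case (less G)
  interpret graph G
    by fact
  show ?case
  proof (cases "verts G = {}")
    case True
    then show ?thesis
      by (rule equitable_list_point_arborable_if_verts_empty)
  next
    case False
    then obtain vs where block: "removable_block k G vs" "length vs = min k (card (verts G))"
      and "vs \<noteq> []"
      using degenerate_2_obtains_removable_block_min less.prems(2,3) by blast
    let ?R = "G \<restriction> (verts G - set vs)"
    have "set vs \<subseteq> verts G"
      using block(1) by (simp add: removable_block_def)
    then have "verts ?R \<subset> verts G"
      using \<open>vs \<noteq> []\<close> by (cases vs) auto
    then have "card (verts ?R) < card (verts G)"
      using finite_verts by (rule psubset_card_mono[rotated])
    moreover have "graph ?R" "degenerate 2 ?R"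
      using graph_induce_subgraph degenerate_subgraph[OF less.prems(2)] subgraph_induce_subgraphI
      by blast+
    moreover have "degree ?R v < 2 * k" if "v \<in> verts ?R" for v
      using that degree_induce_subgraph_le[of "verts G - set vs" v] less.prems(3)[of v] by simp
    ultimately have "equitable_list_point_arborable TYPE('c) k ?R"
      by (rule less.hyps)
    with block \<open>vs \<noteq> []\<close> show ?thesis
      by (intro equitable_list_point_arborable_if_removable_block)
  qed
qed

lemma (in fin_digraph) degree_le_max_degree:
  assumes "v \<in> verts G"
  shows "degree G v \<le> max_degree G"
  using assms by (simp add: max_degree_def)

theorem theorem2:
  fixes G :: "('a, 'b) pre_digraph" and k :: nat
  assumes "graph G"
    and "degenerate 2 G"
    and "int k \<ge> \<lceil>(real (max_degree G) + 1) / 2\<rceil>"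
  shows "equitable_list_point_arborable TYPE('c) k G"
  using assms(1,2)
proof (rule degenerate_2_imp_equitable_list_point_arborable)
  interpret graph G
    by fact
  fix v
  assume "v \<in> verts G"
  then have "degree G v \<le> max_degree G"
    by (rule degree_le_max_degree)
  also have "\<dots> < 2 * k"
    using assms(3) by (simp add: ceiling_le_iff)
  finally show "degree G v < 2 * k" .
qed

end
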